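(* For every integer $k \geq 1$, $\mathfrak{a}_{\mathbf{FIN}_k} \geq \aleph_1$.
   Context: Fix an integer $k \geq 1$. $\mathbf{FIN}_k$ is the set of all maps $p : \omega \to \{0,\dots,k\}$ whose support $\mathrm{supp}(p) = \{n : p(n) \neq 0\}$ is finite and such that $k \in \mathrm{ran}(p)$. For $p,q$ with disjoint supports, $p+q$ is the map equal to $p$ on $\mathrm{supp}(p)$, to $q$ on $\mathrm{supp}(q)$, and $0$ elsewhere. The tetris operation $T$ is given by $T(p)(n) = \max\{p(n)-1,0\}$. Write $p < q$ if $\max\mathrm{supp}(p) < \min\mathrm{supp}(q)$. An infinite block sequence is a sequence $P = (p_n)_{n<\omega}$ of elements of $\mathbf{FIN}_k$ with $p_n < p_{n+1}$ for all $n$; the set of these is $\mathbf{FIN}_k^{[\infty]}$. For such $P$, $\langle P \rangle$ is the set of all elements of the form $T^{j_0}(p_{n_0}) + \cdots + T^{j_m}(p_{n_m})$ with $m<\omega$, $n_0 < \cdots < n_m$, $j_0,\dots,j_m < k$ and $\min_i j_i = 0$. A set $X \subseteq \mathbf{FIN}_k$ is small if there is no $R \in \mathbf{FIN}_k^{[\infty]}$ with $\langle R \rangle \subseteq X$. Two sequences $P,Q \in \mathbf{FIN}_k^{[\infty]}$ are almost disjoint if $\langle P \rangle \cap \langle Q \rangle$ is small. A family $\mathcal{A} \subseteq \mathbf{FIN}_k^{[\infty]}$ is almost disjoint if any two distinct members are almost disjoint, and it is a mad family if it is maximal under inclusion among almost disjoint families. $\mathfrak{a}_{\mathbf{FIN}_k}$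 denotes the smallest cardinality of an infinite mad family in $\mathbf{FIN}_k^{[\infty]}$. *)

theory Defs
  imports Complex_Main "HOL-Library.Nat_Bijection"
begin

unbundle cardinal_syntax

definition supp :: "(nat \<Rightarrow> nat) \<Rightarrow> nat set" where
  "supp p = {n. p n \<noteq> 0}"

definition FIN :: "nat \<Rightarrow> (nat \<Rightarrow> nat) set" where
  "FIN k = {p. range p \<subseteq> {0..k} \<and> finite (supp p) \<and> k \<in> range p}"

definition fin_plus :: "(nat \<Rightarrow> nat) \<Rightarrow> (nat \<Rightarrow> nat) \<Rightarrow> nat \<Rightarrow> nat" where
  "fin_plus p q = (\<lambda>n. if n \<in> supp p then p n else if n \<in> supp q then q n else 0)"

text \<open>\<open>fin_sum x m\<close> is \<open>x 0 + \<dots> + x m\<close>.\<close>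

primrec fin_sum :: "(nat \<Rightarrow> nat \<Rightarrow> nat) \<Rightarrow> nat \<Rightarrow> nat \<Rightarrow> nat" where
  "fin_sum x 0 = x 0"
| "fin_sum x (Suc m) = fin_plus (fin_sum x m) (x (Suc m))"

text \<open>Truncated subtraction on \<open>nat\<close> gives \<open>max {p n - 1, 0}\<close>.\<close>

definition tetris :: "(nat \<Rightarrow> nat) \<Rightarrow> nat \<Rightarrow> nat" where
  "tetris p = (\<lambda>n. p n - 1)"

text \<open>Only meaningful for maps of finite nonempty support, such as elements of \<open>FIN k\<close> with \<open>k \<ge> 1\<close>.\<close>

definition block_less :: "(nat \<Rightarrow> nat) \<Rightarrow> (nat \<Rightarrow> nat) \<Rightarrow> bool" where
  "block_less p q \<longleftrightarrow> Max (supp p) < Min (supp q)"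

definition block_seqs :: "nat \<Rightarrow> (nat \<Rightarrow> nat \<Rightarrow> nat) set" where
  "block_seqs k = {P. (\<forall>n. P n \<in> FIN k) \<and> (\<forall>n. block_less (P n) (P (Suc n)))}"

definition fin_span :: "nat \<Rightarrow> (nat \<Rightarrow> nat \<Rightarrow> nat) \<Rightarrow> (nat \<Rightarrow> nat) set" where
  "fin_span k P =
     {fin_sum (\<lambda>i. (tetris ^^ j i) (P (n i))) m | m n j.
        strict_mono_on {..m} n \<and> (\<forall>i\<le>m. j i < k) \<and> Min (j ` {..m}) = 0}"

definition small :: "nat \<Rightarrow> (nat \<Rightarrow> nat) set \<Rightarrow> bool" where
  "small k X \<longleftrightarrow> \<not> (\<exists>R\<in>block_seqs k. fin_span k R \<subseteq> X)"

definition almost_disjoint :: "nat \<Rightarrow> (nat \<Rightarrow> nat \<Rightarrow> nat) \<Rightarrow> (nat \<Rightarrow> nat \<Rightarrow> nat) \<Rightarrow> bool" where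
  "almost_disjoint k P Q \<longleftrightarrow> small k (fin_span k P \<inter> fin_span k Q)"

definition ad_family :: "nat \<Rightarrow> (nat \<Rightarrow> nat \<Rightarrow> nat) set \<Rightarrow> bool" where
  "ad_family k A \<longleftrightarrow>
     A \<subseteq> block_seqs k \<and> (\<forall>P\<in>A. \<forall>Q\<in>A. P \<noteq> Q \<longrightarrow> almost_disjoint k P Q)"

definition mad_family :: "nat \<Rightarrow> (nat \<Rightarrow> nat \<Rightarrow> nat) set \<Rightarrow> bool" where
  "mad_family k A \<longleftrightarrow> ad_family k A \<and> (\<forall>B. ad_family k B \<and> A \<subseteq> B \<longrightarrow> B = A)"

definition min_inf_mad :: "nat \<Rightarrow> (nat \<Rightarrow> nat \<Rightarrow> nat) set \<Rightarrow> bool" where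
  "min_inf_mad k A \<longleftrightarrow>
     infinite A \<and> mad_family k A \<and> (\<forall>B. infinite B \<and> mad_family k B \<longrightarrow> |A| \<le>o |B| )"

text \<open>
  The least cardinality of an infinite mad family, as a cardinal (well-order relation up to
  \<open>=o\<close>). It is attained, by \<open>ex_min_inf_mad\<close> below, so the choice of \<open>A\<close> is only up to
  equipotence.
\<close>

definition a_FIN :: "nat \<Rightarrow> (nat \<Rightarrow> nat \<Rightarrow> nat) rel" where
  "a_FIN k = |SOME A. min_inf_mad k A|"

definition aleph1 :: "nat set rel" where
  "aleph1 = cardSuc natLeq"

lemma first_in_fin_span:
  assumes "k \<ge> 1"
  shows "P 0 \<in> fin_span k P"
proof -
  have "P 0 = fin_sum (\<lambda>i. (tetris ^^ (0::nat)) (P ((\<lambda>i. i) i))) 0"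
    by simp
  moreover have "strict_mono_on {..0::nat} (\<lambda>i. i)" "Min ((\<lambda>_. 0::nat) ` {..0::nat}) = 0"
    by (auto simp: strict_mono_on_def)
  moreover have "\<forall>i\<le>0::nat. (0::nat) < k"
    using assms by simp
  ultimately show ?thesis
    unfolding fin_span_def mem_Collect_eq by (intro exI conjI)
qed

lemma supp_fin_sum: "supp (fin_sum x m) \<subseteq> (\<Union>i\<le>m. supp (x i))"
proof (induction m)
  case (Suc m)
  have "supp (fin_plus p q) \<subseteq> supp p \<union> supp q" for p q
    by (auto simp: supp_def fin_plus_def)
  from this[of "fin_sum x m" "x (Suc m)"] Suc show ?case
    by (auto simp: atMost_Suc)
qed simp

lemma supp_tetris_pow: "supp ((tetris ^^ j) p) \<subseteq> supp p"
proof (induction j)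
  case (Suc j)
  have "supp (tetris q) \<subseteq> supp q" for q
    by (auto simp: supp_def tetris_def)
  from this[of "(tetris ^^ j) p"] Suc show ?case by auto
qed simp

lemma fin_span_supp:
  assumes "p \<in> fin_span k P"
  shows "supp p \<subseteq> (\<Union>n. supp (P n))"
proof -
  obtain m n j where p: "p = fin_sum (\<lambda>i. (tetris ^^ j i) (P (n i))) m"
    using assms unfolding fin_span_def by blast
  show ?thesis
  proof
    fix x assume "x \<in> supp p"
    then obtain i where "x \<in> supp ((tetris ^^ j i) (P (n i)))"
      unfolding p by (blast dest: subsetD[OF supp_fin_sum])
    then have "x \<in> supp (P (n i))" by (rule subsetD[OF supp_tetris_pow])
    then show "x \<in> (\<Union>n. supp (P n))" by blast
  qed
qed

lemma supp_block_nonempty: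
  assumes "k \<ge> 1" "Q \<in> block_seqs k"
  shows "supp (Q 0) \<noteq> {}"
proof -
  have "k \<in> range (Q 0)"
    using assms(2) by (simp add: block_seqs_def FIN_def)
  then obtain n where "Q 0 n = k" by auto
  then have "n \<in> supp (Q 0)"
    using assms(1) by (simp add: supp_def)
  then show ?thesis by blast
qed

lemma ex_infinite_ad_family:
  assumes k: "k \<ge> 1"
  shows "\<exists>A. infinite A \<and> ad_family k A"
proof -
  define P where "P i n = (\<lambda>x. if x = prod_encode (i, n) then k else 0)" for i n
  have supp_P: "supp (P i n) = {prod_encode (i, n)}" for i n
    using k by (auto simp: supp_def P_def)
  have less: "prod_encode (i, n) < prod_encode (i, Suc n)" for i n
    by (simp add: prod_encode_def)
  have block: "P i \<in> block_seqs k" for i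
  proof -
    have "range (P i n) \<subseteq> {0..k}" for n by (auto simp: P_def)
    moreover have "k \<in> range (P i n)" for n
      by (rule range_eqI[of _ _ "prod_encode (i, n)"]) (simp add: P_def)
    ultimately show ?thesis
      using less by (simp add: block_seqs_def FIN_def block_less_def supp_P)
  qed
  have ad: "almost_disjoint k (P i) (P i')" if "i \<noteq> i'" for i i'
    unfolding almost_disjoint_def small_def
  proof (rule notI, elim bexE)
    fix R assume R: "R \<in> block_seqs k" "fin_span k R \<subseteq> fin_span k (P i) \<inter> fin_span k (P i')"
    then have "R 0 \<in> fin_span k (P i)" "R 0 \<in> fin_span k (P i')"
      using first_in_fin_span[OF k, of R] by auto
    then have "supp (R 0) \<subseteq> (\<Union>n. supp (P i n))" "supp (R 0) \<subseteq> (\<Union>n. supp (P i' n))"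
      by (blast dest: fin_span_supp)+
    then have "supp (R 0) = {}"
      using that by (auto simp: supp_P) (metis (no_types, lifting) UN_E prod_encode_eq prod.inject singletonD subsetD)
    then show False
      using supp_block_nonempty[OF k R(1)] by simp
  qed
  have "inj P"
  proof
    fix i i' assume "P i = P i'"
    then have "supp (P i 0) = supp (P i' 0)" by simp
    then show "i = i'" by (simp add: supp_P)
  qed
  then have "infinite (range P)"
    using finite_imageD by blast
  moreover have "ad_family k (range P)"
    unfolding ad_family_def using block ad by (auto, metis)
  ultimately show ?thesis by blast
qed

lemma ex_min_inf_mad:
  assumes "k \<ge> 1"
  shows "\<exists>A. min_inf_mad k A"
proof -
  obtain A0 where A0: "infinite A0" "ad_family k A0"
    using ex_infinite_ad_family[OF assms] by blast
  define S where "S = {A. ad_family k A \<and> A0 \<subseteq> A}"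
  have "\<exists>M\<in>S. \<forall>X\<in>S. M \<subseteq> X \<longrightarrow> X = M"
  proof (rule subset_Zorn_nonempty)
    show "S \<noteq> {}" using A0 by (auto simp: S_def)
    fix C assume C: "C \<noteq> {}" "subset.chain S C"
    then have mem: "ad_family k A" "A0 \<subseteq> A" if "A \<in> C" for A
      using that by (auto simp: S_def subset.chain_def)
    have "almost_disjoint k P Q" if PQ: "P \<in> \<Union>C" "Q \<in> \<Union>C" "P \<noteq> Q" for P Q
    proof -
      obtain A B where "A \<in> C" "B \<in> C" "P \<in> A" "Q \<in> B" using PQ by blast
      then obtain D where "D \<in> C" "P \<in> D" "Q \<in> D"
        using C(2) by (meson subset_chain_def subsetD)
      then show ?thesis using mem PQ(3) by (auto simp: ad_family_def)
    qed
    moreover have "\<Union>C \<subseteq> block_seqs k"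
      using mem by (auto simp: ad_family_def)
    moreover have "A0 \<subseteq> \<Union>C"
      using C(1) mem by blast
    ultimately show "\<Union>C \<in> S"
      by (auto simp: S_def ad_family_def)
  qed
  then obtain M where M: "M \<in> S" "\<And>X. X \<in> S \<Longrightarrow> M \<subseteq> X \<Longrightarrow> X = M" by blast
  have inf: "infinite M"
    using M(1) A0(1) by (auto simp: S_def dest: finite_subset)
  have mad: "mad_family k M"
    unfolding mad_family_def
  proof (intro conjI allI impI)
    show "ad_family k M" using M(1) by (simp add: S_def)
    fix B assume "ad_family k B \<and> M \<subseteq> B"
    then show "B = M" using M by (auto simp: S_def)
  qed
  let ?R = "card_of ` {A. infinite A \<and> mad_family k A}"
  have "?R \<noteq> {}" "\<forall>r\<in>?R. Well_order r"
    using inf mad card_of_Well_order by blast+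
  then obtain r where "r \<in> ?R" "\<forall>r'\<in>?R. r \<le>o r'"
    using exists_minim_Well_order[of ?R] by meson
  then obtain A where "infinite A" "mad_family k A" "\<forall>r'\<in>?R. |A| \<le>o r'"
    by auto
  then have "min_inf_mad k A"
    unfolding min_inf_mad_def by simp
  then show ?thesis ..
qed

end

theory Submission
  imports Defs "HOL-Library.Infinite_Set"
begin

text \<open>
  An element of the span of \<open>P\<close> is a finitely supported map taking the value \<open>k\<close> whose restriction
  to every block of \<open>P\<close> is a tetris iterate of that block. Hence a span contains the span of every
  block sequence of its elements, and two block sequences are almost disjoint iff the common
  elements of their spans cannot start arbitrarily far out.

  Given a countable almost disjoint family \<open>P 0, P 1, \<dots>\<close>, choose \<open>q n\<close> so far out in \<open>P (n + 1)\<close>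
  that it lies in the span of no \<open>P i\<close> with \<open>i \<le> n\<close>, and so that no block of such a \<open>P i\<close> meets both
  \<open>q n\<close> and a later \<open>q n'\<close>. If an element of the span of \<open>q\<close> built from the \<open>q n\<close> with \<open>n \<ge> i\<close>
  belonged to the span of \<open>P i\<close>, then so would each of its untouched summands \<open>q n\<close>, which is
  excluded. So \<open>q\<close> is almost disjoint from every \<open>P i\<close>, and the family is not maximal.
\<close>

section \<open>Pointwise values of tetris iterates and sums\<close>

text \<open>Subtraction is truncated, so a large \<open>j\<close> stands for a block left out of the
  sum. Every block thus gets a shift, and no list of chosen indices is needed.\<close>

definition coherent :: "(nat \<Rightarrow> nat \<Rightarrow> nat) \<Rightarrow> (nat \<Rightarrow> nat) \<Rightarrow> bool" where
  "coherent P x \<longleftrightarrow> (\<forall>y. x y \<noteq> 0 \<longrightarrow> (\<exists>n. P n y \<noteq> 0)) \<and>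
     (\<forall>n. \<exists>j. \<forall>y. P n y \<noteq> 0 \<longrightarrow> x y = P n y - j)"

definition starts_after :: "nat \<Rightarrow> (nat \<Rightarrow> nat) \<Rightarrow> bool" where
  "starts_after b x \<longleftrightarrow> (\<forall>y. x y \<noteq> 0 \<longrightarrow> b < y)"

lemma tetris_pow: "(tetris ^^ j) p y = p y - j"
  by (induction j) (auto simp: tetris_def)

lemma fin_sum_eq_0: "(\<And>i. i \<le> m \<Longrightarrow> x i y = 0) \<Longrightarrow> fin_sum x m y = 0"
  by (induction m) (simp_all add: fin_plus_def supp_def)

text \<open>\<open>fin_plus\<close> prefers its left argument where supports overlap; with at most
  one summand nonzero at \<open>y\<close> this preference has no effect.\<close>

lemma fin_sum_eq:
  assumes "i \<le> m" "\<And>i'. i' \<le> m \<Longrightarrow> i' \<noteq> i \<Longrightarrow> x i' y = 0"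
  shows "fin_sum x m y = x i y"
  using assms
proof (induction m)
  case (Suc m)
  show ?case
  proof (cases "i = Suc m")
    case True
    then have "fin_sum x m y = 0"
      using Suc.prems by (intro fin_sum_eq_0) auto
    with True show ?thesis by (auto simp: fin_plus_def supp_def)
  next
    case False
    then have "fin_sum x m y = x i y" "x (Suc m) y = 0"
      using Suc by auto
    then show ?thesis by (auto simp: fin_plus_def supp_def)
  qed
qed simp

section \<open>Order and location of the blocks\<close>

lemma FIN_iff:
  "p \<in> FIN k \<longleftrightarrow> (\<forall>y. p y \<le> k) \<and> finite {y. p y \<noteq> 0} \<and> (\<exists>y. p y = k)"
proof -
  have "k \<in> range p \<longleftrightarrow> (\<exists>y. p y = k)" by blast
  moreover have "range p \<subseteq> {0..k} \<longleftrightarrow> (\<forall>y. p y \<le> k)" by (simp add: image_subset_iff)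
  ultimately show ?thesis unfolding FIN_def supp_def by blast
qed

text \<open>For \<open>k \<ge> 1\<close> both supports are finite and nonempty, so
  \<open>Max\<close> and \<open>Min\<close> are genuine and can be traded for a comparison of all
  pairs.\<close>

lemma block_less_iff:
  assumes "k \<ge> 1" "p \<in> FIN k" "q \<in> FIN k"
  shows "block_less p q \<longleftrightarrow> (\<forall>a b. p a \<noteq> 0 \<longrightarrow> q b \<noteq> 0 \<longrightarrow> a < b)"
proof -
  have "finite (supp r)" "supp r \<noteq> {}" if "r \<in> FIN k" for r
    using that assms(1) by (force simp: FIN_iff supp_def)+
  then have "block_less p q \<longleftrightarrow> (\<forall>a\<in>supp p. \<forall>b\<in>supp q. a < b)"
    using assms(2,3) unfolding block_less_def by (simp add: Ball_def) blast
  then show ?thesis by (auto simp: supp_def)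
qed

lemma block_seqs_FIN: "P \<in> block_seqs k \<Longrightarrow> P n \<in> FIN k"
  by (simp add: block_seqs_def)

lemma block_seqs_le: "P \<in> block_seqs k \<Longrightarrow> P n y \<le> k"
  using block_seqs_FIN[of P k n] by (simp add: FIN_iff)

lemma block_seqs_peak: "P \<in> block_seqs k \<Longrightarrow> \<exists>y. P n y = k"
  using block_seqs_FIN[of P k n] by (simp add: FIN_iff)

lemma block_seqs_finite: "P \<in> block_seqs k \<Longrightarrow> finite {y. P n y \<noteq> 0}"
  using block_seqs_FIN[of P k n] by (simp add: FIN_iff)

text \<open>The definition compares consecutive blocks only; transitivity passes through a point of
  each intermediate block, which exists because blocks are nonempty.\<close>

lemma block_seqs_less:
  assumes "k \<ge> 1" "P \<in> block_seqs k" "P m a \<noteq> 0" "P n b \<noteq> 0" "m < n"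
  shows "a < b"
  using assms(3-5)
proof (induction n arbitrary: b)
  case (Suc n)
  have step: "c < d" if "P n c \<noteq> 0" "P (Suc n) d \<noteq> 0" for c d
    using assms(1,2) that block_less_iff[OF assms(1), of "P n" "P (Suc n)"]
    by (simp add: block_seqs_def)
  show ?case
  proof (cases "m = n")
    case True
    with Suc.prems step show ?thesis by blast
  next
    case False
    obtain c where "P n c \<noteq> 0"
      using block_seqs_peak[OF assms(2), of n] assms(1) by force
    then have "c < b" "a < c"
      using step Suc.prems Suc.IH[of c] False by simp_all
    then show ?thesis by simp
  qed
qed simp

lemma block_seqs_unique:
  assumes "k \<ge> 1" "P \<in> block_seqs k" "P m y \<noteq> 0" "P n y \<noteq> 0"
  shows "m = n"
  using block_seqs_less[OF assms(1,2,3,4)] block_seqs_less[OF assms(1,2,4,3)]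
  by (meson less_irrefl linorder_neqE_nat)

text \<open>Points of successive blocks strictly increase. Hence blocks of large index start far
  out, and only finitely many blocks meet a finite set.\<close>

lemma block_seqs_index_le:
  assumes "k \<ge> 1" "P \<in> block_seqs k" "P n y \<noteq> 0"
  shows "n \<le> y"
  using assms(3)
proof (induction n arbitrary: y)
  case (Suc n)
  obtain a where "P n a \<noteq> 0"
    using block_seqs_peak[OF assms(2), of n] assms(1) by force
  then show ?case
    using Suc.IH[of a] Suc.prems block_seqs_less[OF assms(1,2), of n a "Suc n" y] by simp
qed simp

lemma block_seqs_starts_after:
  assumes "k \<ge> 1" "P \<in> block_seqs k" "b < n"
  shows "starts_after b (P n)"
  using block_seqs_index_le[OF assms(1,2)] assms(3) unfolding starts_after_def
  by (meson less_le_trans)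

lemma block_seqsI:
  assumes "k \<ge> 1" "\<And>n. Q n \<in> FIN k"
    and "\<And>n a b. Q n a \<noteq> 0 \<Longrightarrow> Q (Suc n) b \<noteq> 0 \<Longrightarrow> a < b"
  shows "Q \<in> block_seqs k"
  unfolding block_seqs_def mem_Collect_eq block_less_iff[OF assms(1,2,2)]
  using assms(2,3) by blast

section \<open>Spans as sets of coherent maps\<close>

lemma fin_span_imp:
  assumes k: "k \<ge> 1" and P: "P \<in> block_seqs k" and x: "x \<in> fin_span k P"
  shows "coherent P x \<and> finite {y. x y \<noteq> 0} \<and> (\<exists>y. x y = k)"
proof -
  obtain m n j where xe: "x = fin_sum (\<lambda>i. (tetris ^^ j i) (P (n i))) m"
    and n: "strict_mono_on {..m} n" and j: "\<forall>i\<le>m. j i < k" "Min (j ` {..m}) = 0"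
    using x unfolding fin_span_def by blast
  have inj: "i = i'" if "n i = n i'" "i \<le> m" "i' \<le> m" for i i'
    using inj_onD[OF strict_mono_on_imp_inj_on[OF n]] that by simp
  have on: "x y = P (n i) y - j i" if "i \<le> m" "P (n i) y \<noteq> 0" for i y
  proof -
    have "P (n i') y = 0" if "i' \<le> m" "i' \<noteq> i" for i'
      using block_seqs_unique[OF k P \<open>P (n i) y \<noteq> 0\<close>, of "n i'"] inj[of i i'] \<open>i \<le> m\<close> that by blast
    then show ?thesis
      unfolding xe using \<open>i \<le> m\<close> by (subst fin_sum_eq[of i]) (simp_all add: tetris_pow)
  qed
  have off: "x y = 0" if "\<And>i. i \<le> m \<Longrightarrow> P (n i) y = 0" for y
    unfolding xe by (rule fin_sum_eq_0) (simp add: tetris_pow that)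
  have "coherent P x"
    unfolding coherent_def
  proof (intro conjI allI)
    show "x y \<noteq> 0 \<longrightarrow> (\<exists>n. P n y \<noteq> 0)" for y
      using off[of y] by metis
    show "\<exists>j. \<forall>y. P l y \<noteq> 0 \<longrightarrow> x y = P l y - j" for l
    proof (cases "\<exists>i\<le>m. n i = l")
      case True
      then obtain i where "i \<le> m" "n i = l" by blast
      then show ?thesis using on[of i] by (intro exI[of _ "j i"]) simp
    next
      case False
      \<comment> \<open>A block not listed in the sum receives the shift \<open>k\<close>, which
        truncates all its values to 0.\<close>
      have "x y = P l y - k" if "P l y \<noteq> 0" for y
      proof -
        have "x y = 0" using off[of y] block_seqs_unique[OF k P that] False by metis
        then show ?thesis using block_seqs_le[OF P, of l y] by simp
      qed
      then show ?thesis by blast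
    qed
  qed
  moreover have "finite {y. x y \<noteq> 0}"
  proof (rule finite_subset)
    show "{y. x y \<noteq> 0} \<subseteq> (\<Union>i\<le>m. {y. P (n i) y \<noteq> 0})"
    proof
      fix y assume "y \<in> {y. x y \<noteq> 0}"
      then show "y \<in> (\<Union>i\<le>m. {y. P (n i) y \<noteq> 0})" using off[of y] by force
    qed
    show "finite (\<Union>i\<le>m. {y. P (n i) y \<noteq> 0})"
      by (intro finite_UN_I finite_atMost block_seqs_finite[OF P])
  qed
  moreover have "\<exists>y. x y = k"
  proof -
    \<comment> \<open>The summand attaining the minimum exponent 0 is unshifted and keeps its value
      \<open>k\<close>.\<close>
    have "Min (j ` {..m}) \<in> j ` {..m}" by (intro Min_in) auto
    then obtain i where i: "i \<le> m" "j i = 0" using j(2) by auto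
    obtain y where "P (n i) y = k" using block_seqs_peak[OF P] by blast
    then show ?thesis using on[of i y] i k by (intro exI[of _ y]) simp
  qed
  ultimately show ?thesis by blast
qed

lemma fin_span_if:
  assumes k: "k \<ge> 1" and P: "P \<in> block_seqs k"
    and x: "coherent P x" "finite {y. x y \<noteq> 0}" "\<exists>y. x y = k"
  shows "x \<in> fin_span k P"
proof -
  obtain j where j: "\<And>n y. P n y \<noteq> 0 \<Longrightarrow> x y = P n y - j n"
    using x(1) unfolding coherent_def by metis
  \<comment> \<open>Only blocks on which \<open>x\<close> survives are listed, since the exponents
    in a span must stay below \<open>k\<close>.\<close>
  define S where "S = {n. \<exists>y. x y \<noteq> 0 \<and> P n y \<noteq> 0}"
  have "finite S"
  proof (rule finite_subset)
    show "S \<subseteq> (\<Union>y\<in>{y. x y \<noteq> 0}. {..y})"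
      using block_seqs_index_le[OF k P] by (auto simp: S_def)
  qed (use x(2) in auto)
  obtain y0 where y0: "x y0 = k" using x(3) by blast
  then obtain n0 where n0: "P n0 y0 \<noteq> 0" using x(1) k unfolding coherent_def by force
  have "n0 \<in> S" using n0 y0 k unfolding S_def by force
  \<comment> \<open>Block values are at most \<open>k\<close>, so the value \<open>k\<close> of
    \<open>x\<close> at \<open>y0\<close> leaves no room for a positive shift.\<close>
  have "j n0 = 0" using j[OF n0] y0 block_seqs_le[OF P, of n0 y0] k by linarith
  obtain r where r: "strict_mono_on {..<card S} r" "r ` {..<card S} = S"
    using finite_enumerate_mono[OF _ \<open>finite S\<close>] finite_bij_enumerate[OF \<open>finite S\<close>]
    by (auto simp: bij_betw_def strict_mono_on_def)
  \<comment> \<open>\<open>fin_sum\<close> with bound \<open>m\<close> has \<open>m + 1\<close>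
    summands, so \<open>S\<close> must be nonempty; \<open>n0\<close> witnesses this.\<close>
  obtain m where m: "card S = Suc m"
    using \<open>n0 \<in> S\<close> \<open>finite S\<close> by (metis card_gt_0_iff empty_iff gr0_implies_Suc)
  have rm: "strict_mono_on {..m} r" "r ` {..m} = S"
    using r by (simp_all add: m lessThan_Suc_atMost)
  have "j (r i) < k" if "i \<le> m" for i
  proof -
    have "r i \<in> S" using rm that by blast
    then obtain y where "x y \<noteq> 0" "P (r i) y \<noteq> 0" by (auto simp: S_def)
    then show ?thesis using j[of "r i" y] block_seqs_le[OF P, of "r i" y] by linarith
  qed
  moreover have "Min ((\<lambda>i. j (r i)) ` {..m}) = 0"
  proof -
    obtain i where "i \<le> m" "r i = n0" using rm \<open>n0 \<in> S\<close> by auto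
    then have "0 \<in> (\<lambda>i. j (r i)) ` {..m}" using \<open>j n0 = 0\<close> by force
    then show ?thesis by (intro Min_eqI) auto
  qed
  moreover have "x = fin_sum (\<lambda>i. (tetris ^^ j (r i)) (P (r i))) m"
  proof
    fix y
    show "x y = fin_sum (\<lambda>i. (tetris ^^ j (r i)) (P (r i))) m y"
    proof (cases "\<exists>i\<le>m. P (r i) y \<noteq> 0")
      case True
      then obtain i where i: "i \<le> m" "P (r i) y \<noteq> 0" by blast
      have "P (r i') y = 0" if "i' \<le> m" "i' \<noteq> i" for i'
        using block_seqs_unique[OF k P i(2), of "r i'"] that i(1)
          strict_mono_on_imp_inj_on[OF rm(1)] by (auto simp: inj_on_def)
      then show ?thesis
        using i j by (subst fin_sum_eq[of i]) (auto simp: tetris_pow)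
    next
      case False
      have "x y = 0"
      proof (rule ccontr)
        assume "x y \<noteq> 0"
        then obtain n where "P n y \<noteq> 0" using x(1) unfolding coherent_def by blast
        with \<open>x y \<noteq> 0\<close> have "n \<in> S" by (auto simp: S_def)
        with rm(2) False \<open>P n y \<noteq> 0\<close> show False by auto
      qed
      then show ?thesis using False by (subst fin_sum_eq_0) (auto simp: tetris_pow)
    qed
  qed
  ultimately show ?thesis
    unfolding fin_span_def mem_Collect_eq using rm(1)
    by (intro exI[of _ m] exI[of _ r] exI[of _ "\<lambda>i. j (r i)"]) auto
qed

lemma fin_span_iff:
  assumes "k \<ge> 1" "P \<in> block_seqs k"
  shows "x \<in> fin_span k P \<longleftrightarrow> coherent P x \<and> finite {y. x y \<noteq> 0} \<and> (\<exists>y. x y = k)"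
  using fin_span_imp[OF assms] fin_span_if[OF assms] by blast

text \<open>The shift is 0 on the block itself and \<open>k\<close> on all others.\<close>

lemma block_in_fin_span:
  assumes k: "k \<ge> 1" and P: "P \<in> block_seqs k"
  shows "P n \<in> fin_span k P"
proof -
  have "\<exists>j. \<forall>y. P l y \<noteq> 0 \<longrightarrow> P n y = P l y - j" for l
  proof (cases "l = n")
    case True
    then show ?thesis by (intro exI[of _ 0]) simp
  next
    case False
    then show ?thesis
      using block_seqs_unique[OF k P, of l _ n] block_seqs_le[OF P, of l]
      by (intro exI[of _ k]) fastforce
  qed
  then show ?thesis
    using block_seqs_FIN[OF P, of n] unfolding fin_span_iff[OF k P] coherent_def FIN_iff by blast
qed

lemma fin_span_subset_FIN:
  assumes k: "k \<ge> 1" and P: "P \<in> block_seqs k"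
  shows "fin_span k P \<subseteq> FIN k"
proof
  fix x assume x: "x \<in> fin_span k P"
  have "x y \<le> k" for y
  proof (cases "x y = 0")
    case False
    then obtain n j where "x y = P n y - j"
      using x unfolding fin_span_iff[OF k P] coherent_def by blast
    then show ?thesis using block_seqs_le[OF P, of n y] by linarith
  qed simp
  then show "x \<in> FIN k" using x unfolding fin_span_iff[OF k P] FIN_iff by blast
qed

text \<open>Shifts compose: a shift of \<open>P n\<close> by \<open>i\<close> followed by one by
  \<open>j\<close> is a shift by \<open>i + j\<close>. This yields a single shift on
  \<open>P n\<close> because at most one \<open>R m\<close> meets that block.\<close>

lemma fin_span_mono:
  assumes k: "k \<ge> 1" and P: "P \<in> block_seqs k" and R: "R \<in> block_seqs k"
    and sub: "\<And>n. R n \<in> fin_span k P"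
  shows "fin_span k R \<subseteq> fin_span k P"
proof
  fix z assume z: "z \<in> fin_span k R"
  have cR: "coherent P (R n)" for n using sub fin_span_iff[OF k P] by blast
  have cz: "coherent R z" using z fin_span_iff[OF k R] by blast
  have "\<exists>n. P n y \<noteq> 0" if "z y \<noteq> 0" for y
    using that cz cR unfolding coherent_def by blast
  moreover have "\<exists>j. \<forall>y. P n y \<noteq> 0 \<longrightarrow> z y = P n y - j" for n
  proof (cases "\<exists>m y. P n y \<noteq> 0 \<and> R m y \<noteq> 0")
    case False
    then have "z y = P n y - k" if "P n y \<noteq> 0" for y
      using that cz block_seqs_le[OF P, of n y] unfolding coherent_def by fastforce
    then show ?thesis by blast
  next
    case True
    \<comment> \<open>If any value of the block survives a shift, then so does its largest value,
      attained at \<open>a\<close>.\<close>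
    obtain a where a: "P n a = k" using block_seqs_peak[OF P] by blast
    have peak: "R m a \<noteq> 0" if "P n y \<noteq> 0" "R m y \<noteq> 0" for m y
    proof -
      obtain j where j: "\<And>y. P n y \<noteq> 0 \<Longrightarrow> R m y = P n y - j"
        using cR unfolding coherent_def by blast
      have "j < k" using j[OF that(1)] that(2) block_seqs_le[OF P, of n y] by linarith
      then show ?thesis using j[of a] a by simp
    qed
    obtain m y0 where m: "P n y0 \<noteq> 0" "R m y0 \<noteq> 0" using True by blast
    \<comment> \<open>Elements meeting the same block share its peak \<open>a\<close>, so only \<open>R m\<close> meets \<open>P n\<close>.\<close>
    have only: "m' = m" if "P n y \<noteq> 0" "R m' y \<noteq> 0" for m' y
      using peak[OF that] peak[OF m] block_seqs_unique[OF k R] by blast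
    obtain i where i: "\<And>y. P n y \<noteq> 0 \<Longrightarrow> R m y = P n y - i"
      using cR unfolding coherent_def by blast
    obtain j where j: "\<And>y. R m y \<noteq> 0 \<Longrightarrow> z y = R m y - j"
      using cz unfolding coherent_def by blast
    have "z y = P n y - (i + j)" if y: "P n y \<noteq> 0" for y
    proof (cases "R m y = 0")
      case True
      then have "z y = 0" using only[OF y] cz unfolding coherent_def by metis
      then show ?thesis using i[OF y] True by simp
    next
      case False
      then show ?thesis using i[OF y] j by simp
    qed
    then show ?thesis by blast
  qed
  ultimately show "z \<in> fin_span k P"
    using z unfolding fin_span_iff[OF k P] fin_span_iff[OF k R] coherent_def by blast
qed

section \<open>Almost disjointness in terms of starting points\<close>

lemma finite_nat_bound:
  "finite {y::nat. p y} \<Longrightarrow> \<exists>b. \<forall>y. p y \<longrightarrow> y \<le> b"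
  by (simp add: finite_nat_set_iff_bounded_le)

text \<open>If common elements start arbitrarily far out, choosing each beyond the support of the
  previous one gives a block sequence whose span lies in both spans by \<open>fin_span_mono\<close>.
  Conversely, a common subsequence \<open>R\<close> has blocks starting beyond any bound.\<close>

lemma almost_disjoint_iff:
  assumes k: "k \<ge> 1" and P: "P \<in> block_seqs k" and Q: "Q \<in> block_seqs k"
  shows "almost_disjoint k P Q \<longleftrightarrow>
    (\<exists>b. \<forall>x \<in> fin_span k P \<inter> fin_span k Q. \<not> starts_after b x)"
proof
  assume ad: "almost_disjoint k P Q"
  show "\<exists>b. \<forall>x \<in> fin_span k P \<inter> fin_span k Q. \<not> starts_after b x"
  proof (rule ccontr)
    assume "\<not> ?thesis"
    then have far: "\<exists>x. x \<in> fin_span k P \<inter> fin_span k Q \<and> starts_after b x" for b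
      by blast
    have "\<exists>R. \<forall>n. R n \<in> fin_span k P \<inter> fin_span k Q \<and>
        (\<forall>a b. R n a \<noteq> 0 \<longrightarrow> R (Suc n) b \<noteq> 0 \<longrightarrow> a < b)"
    proof (rule dependent_nat_choice)
      show "\<exists>x. x \<in> fin_span k P \<inter> fin_span k Q" using far by blast
      fix x assume "x \<in> fin_span k P \<inter> fin_span k Q"
      then have "finite {y. x y \<noteq> 0}" using fin_span_iff[OF k P] by blast
      from finite_nat_bound[OF this] obtain b where b: "\<And>y. x y \<noteq> 0 \<Longrightarrow> y \<le> b" by blast
      from far obtain x' where "x' \<in> fin_span k P \<inter> fin_span k Q" "starts_after b x'" by blast
      moreover from this(2) have "\<forall>a b. x a \<noteq> 0 \<longrightarrow> x' b \<noteq> 0 \<longrightarrow> a < b"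
        using b le_less_trans unfolding starts_after_def by blast
      ultimately show "\<exists>x'. x' \<in> fin_span k P \<inter> fin_span k Q \<and>
          (\<forall>a b. x a \<noteq> 0 \<longrightarrow> x' b \<noteq> 0 \<longrightarrow> a < b)"
        by blast
    qed
    then obtain R where R: "\<And>n. R n \<in> fin_span k P" "\<And>n. R n \<in> fin_span k Q"
        "\<And>n a b. R n a \<noteq> 0 \<Longrightarrow> R (Suc n) b \<noteq> 0 \<Longrightarrow> a < b"
      by blast
    have RB: "R \<in> block_seqs k"
      using R fin_span_subset_FIN[OF k P] by (intro block_seqsI[OF k]) blast+
    have "fin_span k R \<subseteq> fin_span k P \<inter> fin_span k Q"
      using fin_span_mono[OF k P RB R(1)] fin_span_mono[OF k Q RB R(2)] by blast
    with RB show False using ad unfolding almost_disjoint_def small_def by blast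
  qed
next
  assume "\<exists>b. \<forall>x \<in> fin_span k P \<inter> fin_span k Q. \<not> starts_after b x"
  then obtain b where b: "\<And>x. x \<in> fin_span k P \<inter> fin_span k Q \<Longrightarrow> \<not> starts_after b x" by blast
  show "almost_disjoint k P Q"
    unfolding almost_disjoint_def small_def
  proof (rule notI, elim bexE)
    fix R assume R: "R \<in> block_seqs k" "fin_span k R \<subseteq> fin_span k P \<inter> fin_span k Q"
    then have "R (Suc b) \<in> fin_span k P \<inter> fin_span k Q"
      using block_in_fin_span[OF k R(1)] by blast
    then show False using b block_seqs_starts_after[OF k R(1), of b "Suc b"] by blast
  qed
qed

text \<open>Consequently a block sequence almost disjoint from all members of a family is not itself
  a member.\<close>

lemma almost_disjoint_irrefl:
  assumes "k \<ge> 1" "P \<in> block_seqs k"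
  shows "\<not> almost_disjoint k P P"
  using assms(2) unfolding almost_disjoint_def small_def by blast

lemma almost_disjoint_sym: "almost_disjoint k P Q \<longleftrightarrow> almost_disjoint k Q P"
  by (simp add: almost_disjoint_def Int_commute)

section \<open>Diagonalization against a countable family\<close>

text \<open>The witness is a late block of \<open>P (Suc n)\<close>: this sequence is almost
  disjoint from each \<open>P i\<close> with \<open>i \<le> n\<close>, so its span shares no element
  with theirs beyond a certain point.\<close>

lemma ex_avoiding:
  fixes P :: "nat \<Rightarrow> nat \<Rightarrow> nat \<Rightarrow> nat"
  assumes k: "k \<ge> 1" and P: "\<And>i. P i \<in> block_seqs k"
    and ad: "\<And>i i'. i \<noteq> i' \<Longrightarrow> almost_disjoint k (P i) (P i')"
  shows "\<exists>q \<in> FIN k. starts_after b q \<and> (\<forall>i\<le>n. q \<notin> fin_span k (P i))"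
proof -
  have "\<exists>c. \<forall>x \<in> fin_span k (P (Suc n)) \<inter> fin_span k (P i). \<not> starts_after c x" if "i \<le> n" for i
    using ad[of "Suc n" i] that almost_disjoint_iff[OF k P P] by simp
  then obtain c where c: "\<And>i x. i \<le> n \<Longrightarrow> x \<in> fin_span k (P (Suc n)) \<Longrightarrow> x \<in> fin_span k (P i)
      \<Longrightarrow> \<not> starts_after (c i) x"
    by (metis IntI)
  \<comment> \<open>The sum serves as a common upper bound of the finitely many
    \<open>c i\<close>.\<close>
  define N where "N = Suc (b + (\<Sum>i\<le>n. c i))"
  have "c i < N" if "i \<le> n" for i
    using member_le_sum[of i "{..n}" c] that by (simp add: N_def)
  then have "P (Suc n) N \<notin> fin_span k (P i)" if "i \<le> n" for i
    using that c block_in_fin_span[OF k P] block_seqs_starts_after[OF k P] by blast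
  moreover have "starts_after b (P (Suc n) N)"
    by (rule block_seqs_starts_after[OF k P]) (simp add: N_def)
  ultimately show ?thesis using block_seqs_FIN[OF P] by blast
qed

text \<open>A block meeting the support of \<open>q\<close> at \<open>y\<close> has index at most
  \<open>y\<close>, so finitely many finite blocks are involved.\<close>

lemma blocks_meeting_bound:
  assumes k: "k \<ge> 1" and P: "P \<in> block_seqs k" and q: "q \<in> FIN k"
  shows "\<exists>b. \<forall>m y y'. q y \<noteq> 0 \<longrightarrow> P m y \<noteq> 0 \<longrightarrow> P m y' \<noteq> 0 \<longrightarrow> y' \<le> b"
proof -
  have fin: "finite (\<Union>y\<in>{y. q y \<noteq> 0}. \<Union>m\<le>y. {y'. P m y' \<noteq> 0})"
    using q by (intro finite_UN_I finite_atMost block_seqs_finite[OF P]) (simp add: FIN_iff)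
  have "finite {y'. \<exists>m y. q y \<noteq> 0 \<and> P m y \<noteq> 0 \<and> P m y' \<noteq> 0}"
    by (rule finite_subset[OF _ fin]) (use block_seqs_index_le[OF k P] in blast)
  from finite_nat_bound[OF this] show ?thesis by blast
qed

lemma ex_almost_disjoint_from_sequence:
  fixes P :: "nat \<Rightarrow> nat \<Rightarrow> nat \<Rightarrow> nat"
  assumes k: "k \<ge> 1" and P: "\<And>i. P i \<in> block_seqs k"
    and ad: "\<And>i i'. i \<noteq> i' \<Longrightarrow> almost_disjoint k (P i) (P i')"
  shows "\<exists>Q \<in> block_seqs k. \<forall>i. almost_disjoint k Q (P i)"
proof -
  define good where "good n q \<longleftrightarrow> q \<in> FIN k \<and> (\<forall>i\<le>n. q \<notin> fin_span k (P i))" for n q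
  \<comment> \<open>The bound \<open>b\<close> lies beyond \<open>q\<close> and beyond every block
    of an earlier \<open>P i\<close> that meets \<open>q\<close>, while \<open>q'\<close> starts
    after \<open>b\<close>; no such block can reach \<open>q'\<close>.\<close>
  define sep where "sep n q q' \<longleftrightarrow> (\<exists>b. (\<forall>y. q y \<noteq> 0 \<longrightarrow> y \<le> b) \<and> starts_after b q' \<and>
      (\<forall>i\<le>n. \<forall>m y y'. q y \<noteq> 0 \<longrightarrow> P i m y \<noteq> 0 \<longrightarrow> P i m y' \<noteq> 0 \<longrightarrow> y' \<le> b))"
    for n :: nat and q q' :: "nat \<Rightarrow> nat"
  have "\<exists>Q. \<forall>n. good n (Q n) \<and> sep n (Q n) (Q (Suc n))"
  proof (rule dependent_nat_choice)
    show "\<exists>q. good 0 q" using ex_avoiding[of k P, OF k P ad] unfolding good_def by blast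
    fix q n assume "good n q"
    then have q: "q \<in> FIN k" by (simp add: good_def)
    then obtain b0 where b0: "\<And>y. q y \<noteq> 0 \<Longrightarrow> y \<le> b0"
      using finite_nat_bound[of "\<lambda>y. q y \<noteq> 0"] by (auto simp: FIN_iff)
    obtain c where c: "\<And>i m y y'. q y \<noteq> 0 \<Longrightarrow> P i m y \<noteq> 0 \<Longrightarrow> P i m y' \<noteq> 0 \<Longrightarrow> y' \<le> c i"
      using blocks_meeting_bound[OF k P q] by metis
    define b where "b = b0 + (\<Sum>i\<le>n. c i)"
    have "c i \<le> b" if "i \<le> n" for i
      using member_le_sum[of i "{..n}" c] that by (simp add: b_def)
    then have "\<forall>i\<le>n. \<forall>m y y'. q y \<noteq> 0 \<longrightarrow> P i m y \<noteq> 0 \<longrightarrow> P i m y' \<noteq> 0 \<longrightarrow> y' \<le> b"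
      using c by (meson le_trans)
    moreover have "\<forall>y. q y \<noteq> 0 \<longrightarrow> y \<le> b" using b0 by (auto simp: b_def intro: trans_le_add1)
    moreover obtain q' where "good (Suc n) q'" "starts_after b q'"
      using ex_avoiding[of k P, OF k P ad] unfolding good_def by blast
    ultimately show "\<exists>q'. good (Suc n) q' \<and> sep n q q'"
      unfolding sep_def by blast
  qed
  then obtain Q where good: "\<And>n. good n (Q n)" and sep: "\<And>n. sep n (Q n) (Q (Suc n))" by blast
  have Q: "Q \<in> block_seqs k"
  proof (rule block_seqsI[OF k])
    show "Q n \<in> FIN k" for n using good by (simp add: good_def)
    show "a < b" if "Q n a \<noteq> 0" "Q (Suc n) b \<noteq> 0" for n a b
      using sep[of n] that unfolding sep_def starts_after_def by (meson le_less_trans)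
  qed
  \<comment> \<open>\<open>sep\<close> concerns consecutive members only; if \<open>n'\<close>
    exceeds \<open>Suc n\<close>, a point \<open>a\<close> of \<open>Q (Suc n)\<close> lies between
    the bound \<open>b\<close> and \<open>y'\<close>.\<close>
  have apart: False
    if prems: "i \<le> n" "n < n'" "Q n y \<noteq> 0" "Q n' y' \<noteq> 0" "P i m y \<noteq> 0" "P i m y' \<noteq> 0"
    for i n n' y y' m
  proof -
    obtain b where b: "starts_after b (Q (Suc n))" "y' \<le> b"
      using sep[of n] prems unfolding sep_def by blast
    obtain a where a: "Q (Suc n) a \<noteq> 0"
      using block_seqs_peak[OF Q, of "Suc n"] k by force
    have "b < a" using a b unfolding starts_after_def by blast
    moreover have "b < y'" if "n' = Suc n"
      using b \<open>Q n' y' \<noteq> 0\<close> that unfolding starts_after_def by blast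
    moreover have "a < y'" if "Suc n < n'"
      using block_seqs_less[OF k Q a \<open>Q n' y' \<noteq> 0\<close> that] .
    ultimately show False using b(2) \<open>n < n'\<close> by (metis Suc_lessI leD less_trans)
  qed
  have "almost_disjoint k Q (P i)" for i
  proof -
    \<comment> \<open>Starting after the first \<open>i\<close> members of \<open>Q\<close> leaves
      only members of index at least \<open>i\<close>, to which \<open>good\<close> and
      \<open>apart\<close> apply.\<close>
    obtain b where b: "\<And>n y. n < i \<Longrightarrow> Q n y \<noteq> 0 \<Longrightarrow> y \<le> b"
    proof -
      have "finite (\<Union>n<i. {y. Q n y \<noteq> 0})"
        by (intro finite_UN_I finite_lessThan block_seqs_finite[OF Q])
      then have "finite {y. \<exists>n<i. Q n y \<noteq> 0}"
        by (rule rev_finite_subset) blast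
      from finite_nat_bound[OF this] show ?thesis using that by blast
    qed
    have "\<not> starts_after b z" if z: "z \<in> fin_span k Q" "z \<in> fin_span k (P i)" for z
    proof
      assume far: "starts_after b z"
      have late: "i \<le> n" if "z y \<noteq> 0" "Q n y \<noteq> 0" for n y
        using far b[OF _ that(2)] that(1) unfolding starts_after_def by (meson leD not_le)
      have zQ: "coherent Q z" "\<exists>y. z y = k" using z(1) fin_span_iff[OF k Q] by blast+
      have zP: "coherent (P i) z" using z(2) fin_span_iff[OF k P] by blast
      obtain y0 where y0: "z y0 = k" using zQ by blast
      then obtain n where n: "Q n y0 \<noteq> 0" using zQ(1) k unfolding coherent_def by force
      obtain j where j: "\<And>y. Q n y \<noteq> 0 \<Longrightarrow> z y = Q n y - j"
        using zQ(1) unfolding coherent_def by blast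
      \<comment> \<open>The peak of \<open>z\<close> singles out a member \<open>Q n\<close> that
        enters \<open>z\<close> unshifted.\<close>
      have "j = 0" using j[OF n] y0 k block_seqs_le[OF Q, of n y0] by linarith
      with j have zn: "\<And>y. Q n y \<noteq> 0 \<Longrightarrow> z y = Q n y" by simp
      have "i \<le> n" using late[OF _ n] y0 k by simp
      have "coherent (P i) (Q n)"
        unfolding coherent_def
      proof (intro conjI allI impI)
        show "\<exists>m. P i m y \<noteq> 0" if "Q n y \<noteq> 0" for y
          using zn[OF that] that zP unfolding coherent_def by metis
        show "\<exists>j. \<forall>y. P i m y \<noteq> 0 \<longrightarrow> Q n y = P i m y - j" for m
        proof (cases "\<exists>y. Q n y \<noteq> 0 \<and> P i m y \<noteq> 0")
          case False
          then show ?thesis using block_seqs_le[OF P, of i m] by (intro exI[of _ k]) auto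
        next
          case True
          then obtain y1 where y1: "Q n y1 \<noteq> 0" "P i m y1 \<noteq> 0" by blast
          \<comment> \<open>On a block meeting \<open>Q n\<close>, a discrepancy would come from
            another member \<open>Q n'\<close> meeting the same block, which \<open>apart\<close>
            forbids in either order. The shift of \<open>z\<close> on this block therefore serves
            for \<open>Q n\<close>.\<close>
          have "z y = Q n y" if y: "P i m y \<noteq> 0" for y
          proof (rule ccontr)
            assume ne: "z y \<noteq> Q n y"
            then have "Q n y = 0" using zn by blast
            with ne have "z y \<noteq> 0" by simp
            then obtain n' where n': "Q n' y \<noteq> 0" using zQ(1) unfolding coherent_def by blast
            then have "n' \<noteq> n" "i \<le> n'" using \<open>Q n y = 0\<close> late \<open>z y \<noteq> 0\<close> by auto
            then show False
              using apart[OF \<open>i \<le> n\<close> _ y1(1) n' y1(2) y] apart[OF \<open>i \<le> n'\<close> _ n' y1(1) y y1(2)]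
              by linarith
          qed
          then show ?thesis using zP unfolding coherent_def by metis
        qed
      qed
      then have "Q n \<in> fin_span k (P i)"
        using block_seqs_FIN[OF Q, of n] unfolding fin_span_iff[OF k P] FIN_iff by blast
      then show False using good[of n] \<open>i \<le> n\<close> unfolding good_def by blast
    qed
    then show ?thesis unfolding almost_disjoint_iff[OF k Q P] by blast
  qed
  with Q show ?thesis by blast
qed

section \<open>Passage to the cardinal bound\<close>

lemma mad_family_not_countably_infinite:
  fixes P :: "nat \<Rightarrow> nat \<Rightarrow> nat \<Rightarrow> nat"
  assumes k: "k \<ge> 1" and mad: "mad_family k A"
  shows "\<not> bij_betw P UNIV A"
proof
  assume bij: "bij_betw P UNIV A"
  have ad: "ad_family k A" using mad by (simp add: mad_family_def)
  have A: "A = range P" and inj: "inj P" using bij by (auto simp: bij_betw_def)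
  have "\<exists>Q \<in> block_seqs k. \<forall>i. almost_disjoint k Q (P i)"
  proof (rule ex_almost_disjoint_from_sequence[OF k])
    show "P i \<in> block_seqs k" for i using ad A by (auto simp: ad_family_def)
    show "almost_disjoint k (P i) (P i')" if "i \<noteq> i'" for i i'
      using ad A injD[OF inj, of i i'] that unfolding ad_family_def by blast
  qed
  then obtain Q where Q: "Q \<in> block_seqs k" "\<And>p. p \<in> A \<Longrightarrow> almost_disjoint k Q p"
    using A by blast
  have "ad_family k (insert Q A)"
    using ad Q almost_disjoint_sym unfolding ad_family_def by blast
  \<comment> \<open>Maximality absorbs \<open>Q\<close> into \<open>A\<close>, making
    \<open>Q\<close> almost disjoint from itself.\<close>
  then have "Q \<in> A" using mad unfolding mad_family_def by blast
  then show False using Q almost_disjoint_irrefl[OF k Q(1)] by blast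
qed

theorem theorem1p4:
  fixes k :: nat
  assumes "k \<ge> 1"
  shows "aleph1 \<le>o a_FIN k"
proof -
  define A where "A = (SOME A. min_inf_mad k A)"
  have "min_inf_mad k A"
    unfolding A_def using ex_min_inf_mad[OF assms] by (rule someI_ex)
  then have A: "infinite A" "mad_family k A" by (auto simp: min_inf_mad_def)
  \<comment> \<open>Being infinite, \<open>A\<close> would otherwise be in bijection with
    \<open>nat\<close>; strictly exceeding \<open>natLeq\<close> then gives its cardinal successor
    as a lower bound.\<close>
  have "\<not> |A| \<le>o natLeq"
  proof
    assume "|A| \<le>o natLeq"
    moreover have "natLeq \<le>o |A|" using A(1) infinite_iff_natLeq_ordLeq by blast
    ultimately have "natLeq =o |A|" by (simp add: ordIso_iff_ordLeq)
    then have "|UNIV :: nat set| =o |A|" using card_of_nat ordIso_transitive by blast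
    then obtain P where "bij_betw P (UNIV :: nat set) A" using card_of_ordIso by blast
    then show False using mad_family_not_countably_infinite[OF assms A(2)] by blast
  qed
  then have "natLeq <o |A|"
    using natLeq_Well_order card_of_Well_order not_ordLeq_iff_ordLess by blast
  then show ?thesis
    unfolding aleph1_def a_FIN_def A_def[symmetric]
    by (intro cardSuc_least natLeq_Card_order card_of_Card_order)
qed

end
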